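(* Let $X$ be a complex Banach space and let $A_0:\operatorname{dom}(A_0)\subseteq X\to X$ and $B_0:\operatorname{dom}(B_0)\subseteq X\to X$ be generators of $C_0$-groups $\{e^{tA_0}\}_{t\in\mathbb R}$ and $\{e^{tB_0}\}_{t\in\mathbb R}$ on $X$, respectively, such that (i) $A_0B_0=B_0A_0$; (ii) $\operatorname{dom}(A_0)\subseteq\operatorname{dom}(B_0)$ and $B_0(\operatorname{dom}(A_0^2))\subseteq\operatorname{dom}(A_0)$; (iii) $A_0^{\pm}:=\pm A_0-B_0$, with domain $\operatorname{dom}(A_0)$, generate $C_0$-groups $\{e^{tA_0^{\pm}}\}_{t\in\mathbb R}$ on $X$, respectively. Then the operator $G_0:\operatorname{dom}(A_0^2)\times\operatorname{dom}(A_0)\subseteq\operatorname{dom}(A_0)\times X\to\operatorname{dom}(A_0)\times X$ defined by $$G_0=\begin{bmatrix}-B_0 & I \\ A_0^2 & -B_0\end{bmatrix}$$ is the generator of the $C_0$-group $\{\mathcal T_0(t)\}_{t\in\mathbb R}$ on $\operatorname{dom}(A_0)\times X$ given by $$\mathcal T_0(t)=\begin{bmatrix}\tfrac12\big(e^{tA_0^+}+e^{tA_0^-}\big)\big|_{\operatorname{dom}(A_0)} & \displaystyle\int_0^te^{(t-\tau)A_0^+}e^{\tau A_0^-}\,d\tau \\[2mm] \tfrac12\big(e^{tA_0^+}-e^{tA_0^-}\big)A_0\big|_{\operatorname{dom}(A_0)} & \tfrac12\big(e^{tA_0^+}+e^{tA_0^-}\big)\end{bmatrix},\qquad t\in\mathbb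 R.$$
   Context: $\operatorname{dom}(A_0)$ carries the graph norm $\|x\|+\|A_0x\|$. The integral is understood in the strong sense, i.e. applied to each $x\in X$. *)

theory Defs
  imports "HOL-Analysis.Analysis"
begin

class complex_vector = real_vector +
  fixes scaleC :: "complex \<Rightarrow> 'a \<Rightarrow> 'a" (infixr "*\<^sub>C" 75)
  assumes scaleC_add_right: "a *\<^sub>C (x + y) = a *\<^sub>C x + a *\<^sub>C y"
    and scaleC_add_left: "(a + b) *\<^sub>C x = a *\<^sub>C x + b *\<^sub>C x"
    and scaleC_scaleC: "a *\<^sub>C b *\<^sub>C x = (a * b) *\<^sub>C x"
    and scaleC_one: "1 *\<^sub>C x = x"
    and scaleC_of_real: "complex_of_real r *\<^sub>C x = r *\<^sub>R x"

class complex_banach = complex_vector + banach +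
  assumes norm_scaleC: "norm (a *\<^sub>C x) = cmod a * norm x"

instantiation prod :: (complex_vector, complex_vector) complex_vector
begin

definition scaleC_prod :: "complex \<Rightarrow> 'a \<times> 'b \<Rightarrow> 'a \<times> 'b" where
  "scaleC_prod a z = (a *\<^sub>C fst z, a *\<^sub>C snd z)"

instance
  by standard
    (auto simp: scaleC_prod_def scaleC_add_right scaleC_add_left scaleC_scaleC scaleC_one
      scaleC_of_real scaleR_prod_def)

end

text \<open>
  A domain carrying its graph norm is not a type, so Banach spaces are given by a carrier \<open>S\<close>
  and a norm \<open>N\<close>, whose values outside \<open>S\<close> are irrelevant.
\<close>

locale complex_banach_on =
  fixes S :: "'a::complex_vector set" and N :: "'a \<Rightarrow> real"
  assumes subspace: "module.subspace scaleC S"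
    and norm_eq_0: "x \<in> S \<Longrightarrow> N x = 0 \<longleftrightarrow> x = 0"
    and norm_triangle: "x \<in> S \<Longrightarrow> y \<in> S \<Longrightarrow> N (x + y) \<le> N x + N y"
    and norm_scale: "x \<in> S \<Longrightarrow> N (a *\<^sub>C x) = cmod a * N x"
    and complete: "(\<And>n. f n \<in> S) \<Longrightarrow>
      (\<And>e. e > 0 \<Longrightarrow> \<exists>k. \<forall>m\<ge>k. \<forall>n\<ge>k. N (f m - f n) < e) \<Longrightarrow>
      \<exists>l\<in>S. (\<lambda>n. N (f n - l)) \<longlonglongrightarrow> 0"

definition bounded_clinear_on ::
    "'a::complex_vector set \<Rightarrow> ('a \<Rightarrow> real) \<Rightarrow> ('a \<Rightarrow> 'a) \<Rightarrow> bool" where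
  "bounded_clinear_on S N F \<longleftrightarrow>
     (\<forall>x\<in>S. F x \<in> S) \<and>
     (\<forall>x\<in>S. \<forall>y\<in>S. F (x + y) = F x + F y) \<and>
     (\<forall>a. \<forall>x\<in>S. F (a *\<^sub>C x) = a *\<^sub>C F x) \<and>
     (\<exists>K. \<forall>x\<in>S. N (F x) \<le> K * N x)"

definition C0_group ::
    "'a::complex_vector set \<Rightarrow> ('a \<Rightarrow> real) \<Rightarrow> (real \<Rightarrow> 'a \<Rightarrow> 'a) \<Rightarrow> bool" where
  "C0_group S N T \<longleftrightarrow>
     complex_banach_on S N \<and>
     (\<forall>t. bounded_clinear_on S N (T t)) \<and>
     (\<forall>x\<in>S. T 0 x = x) \<and>
     (\<forall>s t. \<forall>x\<in>S. T (s + t) x = T s (T t x)) \<and>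
     (\<forall>x\<in>S. \<forall>t. ((\<lambda>s. N (T s x - T t x)) \<longlongrightarrow> 0) (at t))"

text \<open>
  Unbounded operators are partial functions, so that their equality includes equality of domains
  and \<open>\<circ>\<^sub>m\<close> is the product with its natural domain
  \<open>dom (A \<circ>\<^sub>m B) = {x \<in> dom B. B x \<in> dom A}\<close>.
\<close>

definition generator ::
    "'a::complex_vector set \<Rightarrow> ('a \<Rightarrow> real) \<Rightarrow> (real \<Rightarrow> 'a \<Rightarrow> 'a) \<Rightarrow> ('a \<rightharpoonup> 'a)" where
  "generator S N T =
     (let lim = (\<lambda>x y. y \<in> S \<and> ((\<lambda>t. N ((1 / t) *\<^sub>R (T t x - x) - y)) \<longlongrightarrow> 0) (at 0))
      in (\<lambda>x. Some (THE y. lim x y)) |` {x \<in> S. \<exists>y. lim x y})"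

definition generates_C0_group ::
    "'a::complex_vector set \<Rightarrow> ('a \<Rightarrow> real) \<Rightarrow> ('a \<rightharpoonup> 'a) \<Rightarrow> (real \<Rightarrow> 'a \<Rightarrow> 'a) \<Rightarrow> bool" where
  "generates_C0_group S N A T \<longleftrightarrow> C0_group S N T \<and> A = generator S N T"

definition graph_norm :: "('a::real_normed_vector \<rightharpoonup> 'a) \<Rightarrow> 'a \<Rightarrow> real" where
  "graph_norm A x = norm x + norm (the (A x))"

text \<open>The integral is oriented: \<open>b < a\<close> is allowed.\<close>

definition oriented_integral :: "real \<Rightarrow> real \<Rightarrow> (real \<Rightarrow> 'a::real_normed_vector) \<Rightarrow> 'a" where
  "oriented_integral a b f = (if a \<le> b then integral {a..b} f else - integral {b..a} f)"

definition A_plus :: "('a::ab_group_add \<rightharpoonup> 'a) \<Rightarrow> ('a \<rightharpoonup> 'a) \<Rightarrow> ('a \<rightharpoonup> 'a)" where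
  "A_plus A B = (\<lambda>x. Some (the (A x) - the (B x))) |` dom A"

definition A_minus :: "('a::ab_group_add \<rightharpoonup> 'a) \<Rightarrow> ('a \<rightharpoonup> 'a) \<Rightarrow> ('a \<rightharpoonup> 'a)" where
  "A_minus A B = (\<lambda>x. Some (- the (A x) - the (B x))) |` dom A"

definition G_matrix :: "('a::ab_group_add \<rightharpoonup> 'a) \<Rightarrow> ('a \<rightharpoonup> 'a) \<Rightarrow> ('a \<times> 'a \<rightharpoonup> 'a \<times> 'a)" where
  "G_matrix A B =
     (\<lambda>(x, y). Some (- the (B x) + y, the ((A \<circ>\<^sub>m A) x) - the (B y))) |` (dom (A \<circ>\<^sub>m A) \<times> dom A)"

text \<open>\<open>P\<close> and \<open>M\<close> stand for the groups generated by \<open>A_plus A B\<close> and \<open>A_minus A B\<close>.\<close>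

definition T_matrix ::
    "('a::real_normed_vector \<rightharpoonup> 'a) \<Rightarrow> (real \<Rightarrow> 'a \<Rightarrow> 'a) \<Rightarrow> (real \<Rightarrow> 'a \<Rightarrow> 'a) \<Rightarrow>
     real \<Rightarrow> 'a \<times> 'a \<Rightarrow> 'a \<times> 'a" where
  "T_matrix A P M t = (\<lambda>(x, y).
     ((1 / 2) *\<^sub>R (P t x + M t x) + oriented_integral 0 t (\<lambda>\<tau>. P (t - \<tau>) (M \<tau> y)),
      (1 / 2) *\<^sub>R (P t (the (A x)) - M t (the (A x))) + (1 / 2) *\<^sub>R (P t y + M t y)))"

end

theory Submission
  imports Defs
begin

text \<open>
  Write \<open>E\<close>, \<open>P\<close>, \<open>M\<close> for the groups generated by \<open>A\<close>, \<open>A - B\<close>, \<open>- A - B\<close>, and \<open>C\<close>, \<open>S\<close> for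
  half the sum and half the difference of \<open>P\<close> and \<open>M\<close>. A resolvent of \<open>A\<close> commutes with \<open>B\<close> on
  \<open>dom A\<close>, hence with \<open>P\<close> and \<open>M\<close>; so \<open>P\<close> and \<open>M\<close> commute with \<open>A\<close> and \<open>E\<close>, and uniqueness for the
  Cauchy problem gives \<open>M t = E (- 2 * t) \<circ> P t\<close>. The integral entry is therefore
  \<open>W t = P t \<circ> (\<integral>\<^sub>0\<^sup>t E (- 2 * \<tau>) d\<tau>)\<close>, which maps into \<open>dom A\<close> with \<open>A (W t y) = S t y\<close>, and the group
  law reduces to addition formulas for \<open>C\<close>, \<open>S\<close>, \<open>W\<close>. The generator contains \<open>G_matrix A B\<close> by
  differentiation at 0. Conversely, if the orbit of \<open>(x, y)\<close> is differentiable, adding and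
  subtracting \<open>A\<close> of the first component and the second one shows that \<open>A x + y\<close> and \<open>A x - y\<close>
  lie in the domains of the generators of \<open>P\<close> and \<open>M\<close>, which are both \<open>dom A\<close>.
\<close>

lemma has_vector_derivative_iff_tendsto:
  fixes f :: "real \<Rightarrow> 'a::real_normed_vector"
  shows "(f has_vector_derivative y) (at x) \<longleftrightarrow>
    ((\<lambda>r. (1 / (r - x)) *\<^sub>R (f r - f x)) \<longlongrightarrow> y) (at x)"
proof -
  have "norm ((f r - f x) - (r - x) *\<^sub>R y) / norm (r - x) = norm ((1 / (r - x)) *\<^sub>R (f r - f x) - y)"
    if "r \<noteq> x" for r
  proof -
    have "(f r - f x) - (r - x) *\<^sub>R y = (r - x) *\<^sub>R ((1 / (r - x)) *\<^sub>R (f r - f x) - y)"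
      using that by (simp add: scaleR_diff_right)
    then show ?thesis using that by simp
  qed
  then have "((\<lambda>r. norm ((f r - f x) - (r - x) *\<^sub>R y) / norm (r - x)) \<longlongrightarrow> 0) (at x) \<longleftrightarrow>
      ((\<lambda>r. norm ((1 / (r - x)) *\<^sub>R (f r - f x) - y)) \<longlongrightarrow> 0) (at x)"
    by (intro filterlim_cong refl) (auto simp: eventually_at_filter)
  then show ?thesis
    unfolding has_vector_derivative_def has_derivative_iff_norm
    by (simp add: bounded_linear_scaleR_left tendsto_norm_zero_iff LIM_zero_iff)
qed

lemma zero_derivative_imp_constant:
  fixes f :: "real \<Rightarrow> 'a::real_normed_vector"
  assumes "\<And>t. (f has_vector_derivative 0) (at t)"
  shows "f t = f s"
  using has_derivative_zero_unique[of UNIV f t s] assms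
  by (simp add: has_vector_derivative_def)

lemma module_scaleC: "module (scaleC :: complex \<Rightarrow> 'a \<Rightarrow> 'a::complex_vector)"
  by standard (simp_all add: scaleC_add_right scaleC_add_left scaleC_scaleC scaleC_one)

lemma scaleC_scaleR_commute:
  "a *\<^sub>C r *\<^sub>R x = r *\<^sub>R a *\<^sub>C (x::'a::complex_vector)"
proof -
  have "a *\<^sub>C complex_of_real r *\<^sub>C x = complex_of_real r *\<^sub>C a *\<^sub>C x"
    by (simp add: scaleC_scaleC mult.commute)
  then show "a *\<^sub>C r *\<^sub>R x = r *\<^sub>R a *\<^sub>C x" by (simp add: scaleC_of_real)
qed

lemma bounded_linear_scaleC: "bounded_linear ((*\<^sub>C) a :: 'a \<Rightarrow> 'a::complex_banach)"
  by (rule bounded_linear_intro[where K = "cmod a"])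
    (simp_all add: scaleC_add_right scaleC_scaleR_commute norm_scaleC mult.commute)

lemma generator_eq_Some_iff:
  fixes T :: "real \<Rightarrow> 'a::complex_banach \<Rightarrow> 'a"
  assumes "\<And>x. T 0 x = x"
  shows "generator UNIV norm T x = Some y \<longleftrightarrow> ((\<lambda>t. T t x) has_vector_derivative y) (at 0)"
proof -
  have lim: "((\<lambda>t. norm ((1 / t) *\<^sub>R (T t x - x) - y)) \<longlongrightarrow> 0) (at 0) \<longleftrightarrow>
      ((\<lambda>t. T t x) has_vector_derivative y) (at 0)" for y
    by (simp add: has_vector_derivative_iff_tendsto assms tendsto_norm_zero_iff LIM_zero_iff)
  have "(THE z. ((\<lambda>t. T t x) has_vector_derivative z) (at 0)) = y"
    if "((\<lambda>t. T t x) has_vector_derivative y) (at 0)" for y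
    using that by (rule the_equality) (rule vector_derivative_unique_at[OF _ that])
  then show ?thesis
    unfolding generator_def Let_def by (auto simp: restrict_map_def lim)
qed

subsection \<open>Strongly continuous groups\<close>

locale strongly_continuous_group =
  fixes T :: "real \<Rightarrow> 'a::complex_banach \<Rightarrow> 'a" and A :: "'a \<rightharpoonup> 'a"
  assumes generates: "generates_C0_group UNIV norm A T"
begin

lemma T_zero [simp]: "T 0 x = x"
  using generates by (simp add: generates_C0_group_def C0_group_def)

lemma T_add: "T (s + t) x = T s (T t x)"
  using generates by (simp add: generates_C0_group_def C0_group_def)

lemma T_inverse [simp]: "T (- t) (T t x) = x" "T t (T (- t) x) = x"
  by (simp_all flip: T_add)

lemma T_commute: "T s (T t x) = T t (T s x)"
  by (metis T_add add.commute)

lemma T_scaleC: "T t (a *\<^sub>C x) = a *\<^sub>C T t x"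
  using generates by (simp add: generates_C0_group_def C0_group_def bounded_clinear_on_def)

lemma bounded_linear_T: "bounded_linear (T t)"
proof -
  have *: "bounded_clinear_on UNIV norm (T t)"
    using generates by (simp add: generates_C0_group_def C0_group_def)
  then obtain K where "\<And>x. norm (T t x) \<le> K * norm x"
    by (auto simp: bounded_clinear_on_def)
  then show ?thesis
    using * by (intro bounded_linear_intro[where K = K])
      (auto simp: bounded_clinear_on_def mult.commute simp flip: scaleC_of_real)
qed

sublocale T: bounded_linear "T t" for t
  by (rule bounded_linear_T)

lemma isCont_T: "isCont (\<lambda>s. T s x) t"
  using generates
  by (simp add: generates_C0_group_def C0_group_def isCont_def tendsto_norm_zero_iff LIM_zero_iff)

lemma continuous_on_T: "continuous_on S (\<lambda>s. T s x)"
  by (intro continuous_at_imp_continuous_on ballI isCont_T)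

lemma generator_iff: "A x = Some y \<longleftrightarrow> ((\<lambda>t. T t x) has_vector_derivative y) (at 0)"
  using generates by (simp add: generates_C0_group_def generator_eq_Some_iff)

lemma generator_bounded_linear:
  assumes "bounded_linear K" "\<And>t x. K (T t x) = T t (K x)" "A x = Some y"
  shows "A (K x) = Some (K y)"
  using bounded_linear.has_vector_derivative[OF assms(1) assms(3)[unfolded generator_iff]]
  by (simp add: generator_iff assms(2))

lemma generator_T: "A x = Some y \<Longrightarrow> A (T t x) = Some (T t y)"
  by (rule generator_bounded_linear[OF bounded_linear_T T_commute])

lemma generator_scaleC: "A x = Some y \<Longrightarrow> A (a *\<^sub>C x) = Some (a *\<^sub>C y)"
  by (rule generator_bounded_linear[OF bounded_linear_scaleC]) (simp_all add: T_scaleC)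

lemma generator_scaleR: "A x = Some y \<Longrightarrow> A (r *\<^sub>R x) = Some (r *\<^sub>R y)"
  using generator_scaleC[of x y "complex_of_real r"] by (simp add: scaleC_of_real)

lemma generator_add: "A x = Some u \<Longrightarrow> A y = Some v \<Longrightarrow> A (x + y) = Some (u + v)"
  unfolding generator_iff by (simp add: T.add has_vector_derivative_add)

lemma generator_diff: "A x = Some u \<Longrightarrow> A y = Some v \<Longrightarrow> A (x - y) = Some (u - v)"
  unfolding generator_iff by (simp add: T.diff has_vector_derivative_diff)

lemma generator_zero: "A 0 = Some 0"
  unfolding generator_iff by (simp add: T.zero)

lemma has_vector_derivative_T:
  assumes "A x = Some y"
  shows "((\<lambda>t. T t x) has_vector_derivative T t y) (at t)"
proof -
  have "((\<lambda>s. T t (T s x)) has_vector_derivative T t y) (at 0)"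
    using assms unfolding generator_iff by (rule T.has_vector_derivative)
  moreover have "((\<lambda>s. s - t) has_vector_derivative 1) (at t)"
    by (auto intro!: derivative_eq_intros)
  ultimately have "((\<lambda>s. T t (T s x)) \<circ> (\<lambda>s. s - t) has_vector_derivative 1 *\<^sub>R T t y) (at t)"
    by (intro vector_diff_chain_at) simp_all
  then show ?thesis by (simp add: o_def flip: T_add)
qed

lemma uniformly_bounded:
  obtains K where "K > 0" "\<And>t x. \<bar>t\<bar> \<le> r \<Longrightarrow> norm (T t x) \<le> K * norm x"
proof -
  define F where "F n = {x. \<forall>t\<in>{-r..r}. norm (T t x) \<le> real n}" for n
  have closed: "closed (F n)" for n
  proof -
    have "F n = (\<Inter>t\<in>{-r..r}. {x. norm (T t x) \<le> real n})"
      by (auto simp: F_def)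
    moreover have "closed {x. norm (T t x) \<le> real n}" for t
      by (intro closed_Collect_le continuous_intros T.continuous_on)
    ultimately show ?thesis by auto
  qed
  have "\<exists>n. x \<in> F n" for x
  proof -
    have "compact ((\<lambda>t. T t x) ` {-r..r})"
      by (intro compact_continuous_image continuous_on_T compact_Icc)
    then obtain B where "\<forall>z\<in>(\<lambda>t. T t x) ` {-r..r}. norm z \<le> B"
      using compact_imp_bounded bounded_iff by metis
    moreover obtain n where "B \<le> real n" using real_arch_simple by blast
    ultimately show ?thesis by (force simp: F_def intro: order_trans)
  qed
  then have "\<Union> (range F) = UNIV" by auto
  then have "\<exists>n. interior (F n) \<noteq> {}"
    using Met_TC.metric_Baire_category_alt[of "range F"] closed
    by (auto simp: complete_UNIV) (metis empty_not_UNIV rangeE)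
  then obtain n x0 where "x0 \<in> interior (F n)" by auto
  then obtain e where e: "e > 0" "cball x0 e \<subseteq> F n"
    by (meson mem_interior_cball)
  define K where "K = 2 * (real n + 1) / e"
  have "norm (T t x) \<le> K * norm x" if "\<bar>t\<bar> \<le> r" for t x
  proof (cases "x = 0")
    case False
    define z where "z = (e / norm x) *\<^sub>R x"
    have "norm z = e" using False e by (simp add: z_def)
    then have "x0 + z \<in> F n" "x0 \<in> F n"
      using e by (auto simp: subset_iff dist_norm)
    then have "norm (T t (x0 + z)) \<le> n" "norm (T t x0) \<le> n"
      using that by (simp_all add: F_def abs_le_iff)
    moreover have "T t z = T t (x0 + z) - T t x0" by (simp add: T.add)
    ultimately have "norm (T t z) \<le> 2 * (real n + 1)"
      using norm_triangle_ineq4[of "T t (x0 + z)" "T t x0"] by simp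
    moreover have "norm (T t z) = e / norm x * norm (T t x)"
      using e by (simp add: z_def T.scaleR)
    ultimately show ?thesis
      using False e by (simp add: K_def field_simps)
  qed (simp add: T.zero)
  moreover have "K > 0" using e by (simp add: K_def)
  ultimately show ?thesis using that by blast
qed

lemma tendsto_T:
  assumes f: "(f \<longlongrightarrow> t) F" and u: "(u \<longlongrightarrow> x) F"
  shows "((\<lambda>i. T (f i) (u i)) \<longlongrightarrow> T t x) F"
proof -
  obtain K where K: "K > 0" "\<And>s z. \<bar>s\<bar> \<le> \<bar>t\<bar> + 1 \<Longrightarrow> norm (T s z) \<le> K * norm z"
    using uniformly_bounded by blast
  have "\<forall>\<^sub>F i in F. dist (f i) t < 1" using f tendstoD zero_less_one by blast
  then have "\<forall>\<^sub>F i in F. norm (T (f i) (u i - x)) \<le> K * norm (u i - x)"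
    by eventually_elim (auto simp: dist_real_def intro!: K)
  moreover have "((\<lambda>i. K * norm (u i - x)) \<longlongrightarrow> 0) F"
    using u by (auto intro!: tendsto_mult_right_zero tendsto_norm_zero simp: LIM_zero_iff)
  ultimately have "((\<lambda>i. T (f i) (u i - x)) \<longlongrightarrow> 0) F"
    by (rule Lim_null_comparison)
  moreover have "((\<lambda>i. T (f i) x) \<longlongrightarrow> T t x) F"
    using isCont_tendsto_compose[OF isCont_T f] .
  ultimately have "((\<lambda>i. T (f i) (u i - x) + T (f i) x) \<longlongrightarrow> 0 + T t x) F"
    by (rule tendsto_add)
  then show ?thesis by (simp add: T.diff)
qed

lemma has_vector_derivative_T_mult:
  assumes u: "(u has_vector_derivative u') (at s)" and a: "A (u s) = Some a"
  shows "((\<lambda>r. T (c * r) (u r)) has_vector_derivative T (c * s) (u' + c *\<^sub>R a)) (at s)"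
proof -
  have "((\<lambda>r. c * r) has_vector_derivative c) (at s)"
    by (auto intro!: derivative_eq_intros)
  from vector_diff_chain_at[OF this has_vector_derivative_T[OF a]]
  have "((\<lambda>r. (1 / (r - s)) *\<^sub>R (T (c * r) (u s) - T (c * s) (u s))) \<longlongrightarrow> c *\<^sub>R T (c * s) a) (at s)"
    by (simp add: o_def has_vector_derivative_iff_tendsto)
  moreover have "((\<lambda>r. T (c * r) ((1 / (r - s)) *\<^sub>R (u r - u s))) \<longlongrightarrow> T (c * s) u') (at s)"
    using u by (intro tendsto_T tendsto_intros) (simp add: has_vector_derivative_iff_tendsto)
  ultimately have "((\<lambda>r. T (c * r) ((1 / (r - s)) *\<^sub>R (u r - u s)) +
      (1 / (r - s)) *\<^sub>R (T (c * r) (u s) - T (c * s) (u s))) \<longlongrightarrow> T (c * s) u' + c *\<^sub>R T (c * s) a) (at s)"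
    by (rule tendsto_add[rotated])
  then show ?thesis
    by (simp add: has_vector_derivative_iff_tendsto T.diff T.add T.scaleR algebra_simps)
qed

lemma Cauchy_problem_unique:
  assumes "\<And>s. \<exists>a. A (u s) = Some a \<and> (u has_vector_derivative a) (at s)"
  shows "u t = T t (u 0)"
proof -
  have "((\<lambda>r. T (-1 * r) (u r)) has_vector_derivative 0) (at s)" for s
  proof -
    obtain a where a: "A (u s) = Some a" "(u has_vector_derivative a) (at s)"
      using assms by blast
    then show ?thesis using has_vector_derivative_T_mult[OF a(2,1), of "-1"] by (simp add: T.zero)
  qed
  then have "T (-1 * t) (u t) = T (-1 * 0) (u 0)"
    by (rule zero_derivative_imp_constant)
  then have "T (- t) (u t) = u 0" by simp
  then show ?thesis by (metis T_inverse(2))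
qed

end

subsection \<open>Oriented integrals of continuous functions\<close>

lemma oriented_integral_has_vector_derivative:
  fixes f :: "real \<Rightarrow> 'a::banach"
  assumes f: "continuous_on UNIV f"
  shows "((\<lambda>t. oriented_integral 0 t f) has_vector_derivative f t) (at t)"
proof -
  define a where "a = \<bar>t\<bar> + 1"
  have int: "f integrable_on {c..d}" for c d
    using f by (intro integrable_continuous_real) (rule continuous_on_subset, auto)
  have eq: "oriented_integral 0 s f = integral {-a..s} f - integral {-a..0} f" if "s \<in> {-a<..<a}" for s
  proof (cases "0 \<le> s")
    case True
    then show ?thesis
      using Henstock_Kurzweil_Integration.integral_combine[of "-a" 0 s f] int
      by (auto simp: oriented_integral_def a_def algebra_simps)
  next
    case False
    then show ?thesis
      using Henstock_Kurzweil_Integration.integral_combine[of "-a" s 0 f] int that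
      by (auto simp: oriented_integral_def a_def algebra_simps)
  qed
  have "((\<lambda>s. integral {-a..s} f) has_vector_derivative f t) (at t within {-a..a})"
    by (rule integral_has_vector_derivative) (auto simp: a_def intro: continuous_on_subset[OF f])
  then have "((\<lambda>s. integral {-a..s} f) has_vector_derivative f t) (at t within {-a<..<a})"
    by (rule has_vector_derivative_within_subset) auto
  then have "((\<lambda>s. integral {-a..s} f) has_vector_derivative f t) (at t)"
    by (subst (asm) has_vector_derivative_within_open) (auto simp: a_def)
  from has_vector_derivative_diff[OF this has_vector_derivative_const]
  have "((\<lambda>s. integral {-a..s} f - integral {-a..0} f) has_vector_derivative f t) (at t)"
    by simp
  then show ?thesis
    by (rule has_vector_derivative_transform_within_open[where S = "{-a<..<a}"])
      (auto simp: a_def eq[unfolded a_def])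
qed

lemma oriented_integral_eqI:
  fixes f :: "real \<Rightarrow> 'a::banach"
  assumes "continuous_on UNIV f" "\<And>t. (F has_vector_derivative f t) (at t)"
  shows "oriented_integral 0 t f = F t - F 0"
proof -
  have "((\<lambda>t. oriented_integral 0 t f - F t) has_vector_derivative 0) (at t)" for t
    using has_vector_derivative_diff[OF oriented_integral_has_vector_derivative[OF assms(1)] assms(2)]
    by simp
  from zero_derivative_imp_constant[OF this, of t 0]
  have "oriented_integral 0 t f - F t = 0 - F 0" by (simp add: oriented_integral_def)
  then show ?thesis by (simp add: algebra_simps)
qed

lemma oriented_integral_bounded_linear:
  fixes f :: "real \<Rightarrow> 'a::banach" and K :: "'a \<Rightarrow> 'b::banach"
  assumes "bounded_linear K" "continuous_on UNIV f"
  shows "oriented_integral 0 t (\<lambda>s. K (f s)) = K (oriented_integral 0 t f)"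
proof -
  interpret bounded_linear K by fact
  have "oriented_integral 0 t (\<lambda>s. K (f s)) = K (oriented_integral 0 t f) - K (oriented_integral 0 0 f)"
    by (intro oriented_integral_eqI continuous_on assms has_vector_derivative
        oriented_integral_has_vector_derivative)
  then show ?thesis by (simp add: oriented_integral_def zero)
qed

lemma oriented_integral_norm_le:
  fixes f :: "real \<Rightarrow> 'a::banach"
  assumes "continuous_on UNIV f" "\<And>s. \<bar>s\<bar> \<le> \<bar>t\<bar> \<Longrightarrow> norm (f s) \<le> B"
  shows "norm (oriented_integral 0 t f) \<le> B * \<bar>t\<bar>"
  using integral_bound[of 0 t f B] integral_bound[of t 0 f B] assms(2)
    continuous_on_subset[OF assms(1)]
  by (auto simp: oriented_integral_def)

subsection \<open>Integrated orbits and resolvents\<close>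

context strongly_continuous_group
begin

definition J :: "real \<Rightarrow> 'a \<Rightarrow> 'a" where
  "J t x = oriented_integral 0 t (\<lambda>s. T s x)"

lemma J_zero [simp]: "J 0 x = 0"
  by (simp add: J_def oriented_integral_def)

lemma has_vector_derivative_J: "((\<lambda>t. J t x) has_vector_derivative T t x) (at t)"
  unfolding J_def by (rule oriented_integral_has_vector_derivative[OF continuous_on_T])

lemma J_eqI:
  assumes "\<And>t. (F has_vector_derivative T t x) (at t)"
  shows "J t x = F t - F 0"
  unfolding J_def by (rule oriented_integral_eqI[OF continuous_on_T assms])

lemma J_bounded_linear_commute:
  assumes "bounded_linear K" "\<And>t x. K (T t x) = T t (K x)"
  shows "J t (K x) = K (J t x)"
  unfolding J_def
  by (simp add: oriented_integral_bounded_linear[OF assms(1) continuous_on_T] flip: assms(2))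

lemma J_scaleC: "J t (a *\<^sub>C x) = a *\<^sub>C J t x"
  by (rule J_bounded_linear_commute[OF bounded_linear_scaleC]) (simp add: T_scaleC)

lemma bounded_linear_J: "bounded_linear (J t)"
proof -
  obtain K where K: "K > 0" "\<And>s x. \<bar>s\<bar> \<le> \<bar>t\<bar> \<Longrightarrow> norm (T s x) \<le> K * norm x"
    using uniformly_bounded by blast
  show ?thesis
  proof (rule bounded_linear_intro[where K = "K * \<bar>t\<bar>"])
    fix x y
    show "J t (x + y) = J t x + J t y"
      using J_eqI[of "\<lambda>t. J t x + J t y" "x + y" t]
      by (simp add: T.add has_vector_derivative_add has_vector_derivative_J)
    show "J t (r *\<^sub>R x) = r *\<^sub>R J t x" for r
      by (rule J_bounded_linear_commute[OF bounded_linear_scaleR_right]) (simp add: T.scaleR)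
    show "norm (J t x) \<le> norm x * (K * \<bar>t\<bar>)"
      using oriented_integral_norm_le[OF continuous_on_T, of t x "K * norm x"] K
      by (simp add: J_def mult_ac)
  qed
qed

lemma J_add: "J (s + t) x = J s x + T s (J t x)"
proof -
  have "((\<lambda>r. s + r) has_vector_derivative 1) (at t)" for t
    by (auto intro!: derivative_eq_intros)
  from vector_diff_chain_at[OF this has_vector_derivative_J]
  have "((\<lambda>r. J (s + r) x) has_vector_derivative T s (T t x)) (at t)" for t
    by (simp add: o_def T_add)
  moreover have "((\<lambda>r. T s (J r x)) has_vector_derivative T s (T t x)) (at t)" for t
    by (rule T.has_vector_derivative[OF has_vector_derivative_J])
  ultimately have "((\<lambda>r. J (s + r) x - T s (J r x)) has_vector_derivative 0) (at t)" for t
    using has_vector_derivative_diff by fastforce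
  from zero_derivative_imp_constant[OF this, of t 0] show ?thesis
    by (simp add: T.zero algebra_simps)
qed

lemma generator_J: "A (J t x) = Some (T t x - x)"
proof -
  have "((\<lambda>r. r + t) has_vector_derivative 1) (at 0)"
    by (auto intro!: derivative_eq_intros)
  from vector_diff_chain_at[OF this has_vector_derivative_J]
  have "((\<lambda>s. J (s + t) x) has_vector_derivative T t x) (at 0)"
    by (simp add: o_def)
  moreover have "((\<lambda>s. J s x) has_vector_derivative x) (at 0)"
    using has_vector_derivative_J[of x 0] by simp
  ultimately have "((\<lambda>s. J (s + t) x - J s x) has_vector_derivative T t x - x) (at 0)"
    by (rule has_vector_derivative_diff)
  then show ?thesis by (simp add: generator_iff J_add)
qed

lemma J_generator: "A x = Some y \<Longrightarrow> J t y = T t x - x"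
  using J_eqI[OF has_vector_derivative_T, of x y t] by simp

lemma closed_superset_domain:
  assumes "closed C" "dom A \<subseteq> C"
  shows "x \<in> C"
proof (rule Lim_in_closed_set[OF assms(1)])
  show "((\<lambda>t. (1 / t) *\<^sub>R J t x) \<longlongrightarrow> x) (at 0)"
    using has_vector_derivative_J[of x 0] by (simp add: has_vector_derivative_iff_tendsto)
  show "\<forall>\<^sub>F t in at 0. (1 / t) *\<^sub>R J t x \<in> C"
    using assms(2) generator_scaleR[OF generator_J] by (intro always_eventually) auto
qed auto

lemma bounded_linear_eqI:
  assumes "bounded_linear F" "bounded_linear G" "\<And>x y. A x = Some y \<Longrightarrow> F x = G x"
  shows "F x = G x"
proof -
  have "x \<in> {x. F x = G x}"
    using assms
    by (intro closed_superset_domain closed_Collect_eq linear_continuous_on) auto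
  then show ?thesis by simp
qed

lemma commute_T:
  assumes K: "bounded_linear K" and comm: "\<And>x y. A x = Some y \<Longrightarrow> A (K x) = Some (K y)"
  shows "K (T t x) = T t (K x)"
proof (rule bounded_linear_eqI[where F = "\<lambda>x. K (T t x)" and G = "\<lambda>x. T t (K x)"])
  show "K (T t x) = T t (K x)" if "A x = Some y" for x y
    using Cauchy_problem_unique[of "\<lambda>s. K (T s x)" t]
      comm[OF generator_T[OF that]] bounded_linear.has_vector_derivative[OF K has_vector_derivative_T[OF that]]
    by auto
qed (intro bounded_linear_compose[OF K bounded_linear_T] bounded_linear_compose[OF bounded_linear_T K])+

lemma generates_rescaled:
  fixes c \<mu> :: real
  defines "S \<equiv> \<lambda>t x. exp (\<mu> * t) *\<^sub>R T (c * t) x"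
  shows "strongly_continuous_group S (generator UNIV norm S)"
proof
  have "C0_group UNIV norm S"
    unfolding C0_group_def
  proof (intro conjI allI ballI)
    show "complex_banach_on (UNIV :: 'a set) norm"
      using generates by (simp add: generates_C0_group_def C0_group_def)
    fix s t :: real and x :: 'a
    obtain K where K: "\<And>x. norm (T (c * t) x) \<le> norm x * K"
      using T.bounded by blast
    have "norm (S t x) \<le> (exp (\<mu> * t) * K) * norm x" for x
      using K[of x] by (simp add: S_def mult_ac)
    then show "bounded_clinear_on UNIV norm (S t)"
      unfolding bounded_clinear_on_def
      by (auto simp: S_def T.add scaleR_add_right T_scaleC scaleC_scaleR_commute
          simp del: norm_scaleR intro!: exI[of _ "exp (\<mu> * t) * K"])
    show "S 0 x = x" by (simp add: S_def)
    show "S (s + t) x = S s (S t x)"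
      by (simp add: S_def T.scaleR distrib_left exp_add T_add mult.commute)
    have "((\<lambda>s. S s x) \<longlongrightarrow> S t x) (at t)"
      unfolding S_def by (intro tendsto_intros tendsto_T)
    then show "((\<lambda>s. norm (S s x - S t x)) \<longlongrightarrow> 0) (at t)"
      by (simp add: tendsto_norm_zero_iff LIM_zero_iff)
  qed
  then show "generates_C0_group UNIV norm (generator UNIV norm S) S"
    by (simp add: generates_C0_group_def)
qed

lemma generator_rescaled_iff:
  fixes c \<mu> :: real
  assumes "c \<noteq> 0"
  defines "S \<equiv> \<lambda>t x. exp (\<mu> * t) *\<^sub>R T (c * t) x"
  shows "generator UNIV norm S x = Some (c *\<^sub>R y + \<mu> *\<^sub>R x) \<longleftrightarrow> A x = Some y"
proof -
  have S: "generator UNIV norm S x = Some (c *\<^sub>R y + \<mu> *\<^sub>R x) \<longleftrightarrow>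
      ((\<lambda>t. S t x) has_vector_derivative c *\<^sub>R y + \<mu> *\<^sub>R x) (at 0)"
    by (rule generator_eq_Some_iff) (simp add: S_def)
  have exp: "((\<lambda>t. exp (b * t)) has_real_derivative b) (at 0)" for b :: real
    by (auto intro!: derivative_eq_intros)
  show ?thesis
  proof
    assume "generator UNIV norm S x = Some (c *\<^sub>R y + \<mu> *\<^sub>R x)"
    then have "((\<lambda>t. S t x) has_vector_derivative c *\<^sub>R y + \<mu> *\<^sub>R x) (at 0)"
      using S by simp
    from has_vector_derivative_scaleR[OF exp[of "-\<mu>"] this]
    have "((\<lambda>t. T (c * t) x) has_vector_derivative c *\<^sub>R y) (at 0)"
      by (simp add: S_def flip: exp_add)
    then have *: "((\<lambda>t. T (c * t) x) has_vector_derivative c *\<^sub>R y) (at (0 / c))" 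
      by simp
    have "((\<lambda>t. t / c) has_vector_derivative 1 / c) (at 0)"
      using assms(1) by (auto intro!: derivative_eq_intros)
    from vector_diff_chain_at[OF this *] show "A x = Some y"
      using assms(1) by (simp add: generator_iff o_def)
  next
    assume "A x = Some y"
    then have *: "((\<lambda>t. T t x) has_vector_derivative y) (at (c * 0))"
      by (simp add: generator_iff)
    have "((\<lambda>t. c * t) has_vector_derivative c) (at 0)"
      by (auto intro!: derivative_eq_intros)
    from has_vector_derivative_scaleR[OF exp[of \<mu>] vector_diff_chain_at[OF this *]]
    show "generator UNIV norm S x = Some (c *\<^sub>R y + \<mu> *\<^sub>R x)"
      unfolding S by (simp add: S_def o_def)
  qed
qed

text \<open>
  \<open>J\<close> of the rescaled group at time 1 is a right inverse of \<open>\<omega> - A\<close> up to the contraction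
  \<open>K = exp (- \<omega>) T 1\<close>, which a fixed point argument removes.
\<close>

lemma resolvent_exists:
  obtains \<omega> :: real and R :: "'a \<Rightarrow> 'a" where "bounded_linear R"
    "\<And>x. A (R x) = Some (\<omega> *\<^sub>R R x - x)"
    "\<And>x y. A x = Some y \<Longrightarrow> R (\<omega> *\<^sub>R x - y) = x"
proof -
  obtain C where C: "C > 0" "\<And>x. norm (T 1 x) \<le> norm x * C"
    using T.pos_bounded by blast
  define \<omega> where "\<omega> = ln (2 * C)"
  define S where "S = (\<lambda>t x. exp (- \<omega> * t) *\<^sub>R T (1 * t) x)"
  interpret S: strongly_continuous_group S "generator UNIV norm S"
    unfolding S_def by (rule generates_rescaled)
  have gen: "generator UNIV norm S x = Some z \<longleftrightarrow> A x = Some (\<omega> *\<^sub>R x + z)" for x z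
    using generator_rescaled_iff[of 1 "- \<omega>" x "\<omega> *\<^sub>R x + z"] by (simp add: S_def)
  have half: "norm (S 1 x) \<le> 1 / 2 * norm x" for x
    using C by (simp add: S_def \<omega>_def exp_minus field_simps)
  have fixpoint: "\<exists>y. y = x + S 1 y" for x
  proof -
    have "dist (x + S 1 y) (x + S 1 z) \<le> 1 / 2 * dist y z" for y z
      using half[of "y - z"] by (simp add: dist_norm S.T.diff)
    then have "\<exists>!y. x + S 1 y = y"
      by (intro banach_fix_type[where c = "1 / 2"]) auto
    then show ?thesis by metis
  qed
  obtain k where k: "k > 0" "\<And>x. norm (S.J 1 x) \<le> norm x * k"
    using bounded_linear.pos_bounded[OF S.bounded_linear_J] by blast
  have surj: "\<exists>u. A u = Some (\<omega> *\<^sub>R u - x) \<and> norm u \<le> norm x * (2 * k)" for x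
  proof -
    obtain y where y: "y = x + S 1 y" using fixpoint by blast
    then have "S 1 y - y = - x" by (metis add_diff_cancel_right' minus_diff_eq)
    then have "A (S.J 1 y) = Some (\<omega> *\<^sub>R S.J 1 y - x)"
      using S.generator_J[of 1 y] gen by simp
    moreover have "norm y \<le> norm x + norm (S 1 y)"
      using y norm_triangle_ineq by metis
    then have "norm y \<le> 2 * norm x" using half[of y] by simp
    then have "norm (S.J 1 y) \<le> norm x * (2 * k)"
      using order_trans[OF k(2) mult_right_mono[of "norm y" "2 * norm x" k]] k(1) by (simp add: mult_ac)
    ultimately show ?thesis by blast
  qed
  have inj: "u = 0" if "A u = Some (\<omega> *\<^sub>R u)" for u
  proof -
    have "generator UNIV norm S u = Some 0" using that gen by simp
    from S.J_generator[OF this, of 1] have "S 1 u = u"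
      by (simp add: linear_0[OF bounded_linear.linear[OF S.bounded_linear_J]])
    then show ?thesis using half[of u] by simp
  qed
  define R where "R x = (SOME u. A u = Some (\<omega> *\<^sub>R u - x) \<and> norm u \<le> norm x * (2 * k))" for x
  have R: "A (R x) = Some (\<omega> *\<^sub>R R x - x)" "norm (R x) \<le> norm x * (2 * k)" for x
    using someI_ex[OF surj[of x]] by (simp_all add: R_def)
  have R_eqI: "R x = u" if "A u = Some (\<omega> *\<^sub>R u - x)" for x u
    using inj[of "R x - u"] generator_diff[OF R(1) that] by (simp add: algebra_simps)
  have "bounded_linear R"
  proof (rule bounded_linear_intro)
    show "R (x + y) = R x + R y" for x y
      using generator_add[OF R(1) R(1), of x y] by (intro R_eqI) (simp add: algebra_simps)
    show "R (r *\<^sub>R x) = r *\<^sub>R R x" for r x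
      using generator_scaleR[OF R(1), of r x] by (intro R_eqI) (simp add: algebra_simps)
  qed (rule R(2))
  moreover have "R (\<omega> *\<^sub>R x - y) = x" if "A x = Some y" for x y
    by (rule R_eqI) (simp add: that)
  ultimately show ?thesis using that R(1) by blast
qed

lemma generator_closed:
  assumes "x \<longlonglongrightarrow> l" "y \<longlonglongrightarrow> m" "\<And>n. A (x n) = Some (y n)"
  shows "A l = Some m"
proof -
  obtain \<omega> R where R: "bounded_linear R" "\<And>x. A (R x) = Some (\<omega> *\<^sub>R R x - x)"
      "\<And>x y. A x = Some y \<Longrightarrow> R (\<omega> *\<^sub>R x - y) = x"
    by (rule resolvent_exists) (rule that)
  have "(\<lambda>n. R (\<omega> *\<^sub>R x n - y n)) \<longlonglongrightarrow> R (\<omega> *\<^sub>R l - m)"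
    by (intro bounded_linear.tendsto[OF R(1)] tendsto_intros assms)
  then have "x \<longlonglongrightarrow> R (\<omega> *\<^sub>R l - m)" using R(3)[OF assms(3)] by simp
  then have "R (\<omega> *\<^sub>R l - m) = l" using assms(1) by (rule LIMSEQ_unique)
  from R(2)[of "\<omega> *\<^sub>R l - m", unfolded this] show ?thesis by simp
qed

end

subsection \<open>The graph norm\<close>

context strongly_continuous_group
begin

lemma graph_norm_diff:
  assumes "x \<in> dom A" "y \<in> dom A"
  shows "graph_norm A (x - y) = norm (x - y) + norm (the (A x) - the (A y))"
  using assms generator_diff by (fastforce simp: graph_norm_def)

lemma tendsto_graph_norm_iff:
  assumes "\<And>i. f i \<in> dom A \<times> UNIV" "l \<in> dom A \<times> UNIV"
  shows "((\<lambda>i. (\<lambda>(x, y). graph_norm A x + norm y) (f i - l)) \<longlongrightarrow> 0) F \<longleftrightarrow>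
    ((\<lambda>i. fst (f i)) \<longlongrightarrow> fst l) F \<and> ((\<lambda>i. the (A (fst (f i)))) \<longlongrightarrow> the (A (fst l))) F \<and>
    ((\<lambda>i. snd (f i)) \<longlongrightarrow> snd l) F" (is "(?N \<longlongrightarrow> 0) F \<longleftrightarrow> ?R")
proof -
  have N: "?N i = norm (fst (f i) - fst l) + norm (the (A (fst (f i))) - the (A (fst l)))
      + norm (snd (f i) - snd l)" for i
    using assms by (simp add: case_prod_beta graph_norm_diff mem_Times_iff)
  show ?thesis
  proof
    assume *: "(?N \<longlongrightarrow> 0) F"
    have "((\<lambda>i. fst (f i) - fst l) \<longlongrightarrow> 0) F"
      "((\<lambda>i. the (A (fst (f i))) - the (A (fst l))) \<longlongrightarrow> 0) F" "((\<lambda>i. snd (f i) - snd l) \<longlongrightarrow> 0) F"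
      by (auto intro!: Lim_null_comparison[OF always_eventually *] simp: N)
    then show ?R by (simp add: LIM_zero_iff)
  next
    assume ?R
    then have "(?N \<longlongrightarrow> 0 + 0 + 0) F"
      unfolding N by (intro tendsto_add tendsto_norm_zero) (simp_all add: LIM_zero_iff)
    then show "(?N \<longlongrightarrow> 0) F" by simp
  qed
qed

lemma complex_banach_on_graph_norm:
  "complex_banach_on (dom A \<times> (UNIV :: 'a set)) (\<lambda>(x, y). graph_norm A x + norm y)"
proof
  let ?S = "dom A \<times> (UNIV :: 'a set)" and ?N = "\<lambda>(x, y). graph_norm A x + norm y"
  show "module.subspace scaleC ?S"
    unfolding module.subspace_def[OF module_scaleC]
  proof (intro conjI ballI allI)
    show "0 \<in> ?S" using generator_zero by (auto simp: zero_prod_def)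
    fix p :: "'a \<times> 'a" assume "p \<in> ?S"
    then obtain a where a: "A (fst p) = Some a" by auto
    then show "c *\<^sub>C p \<in> ?S" for c
      using generator_scaleC[OF a, of c] by (auto simp: scaleC_prod_def)
    fix q :: "'a \<times> 'a" assume "q \<in> ?S"
    then obtain b where "A (fst q) = Some b" by auto
    from generator_add[OF a this] show "p + q \<in> ?S" by (auto simp: mem_Times_iff)
  qed
  fix p q :: "'a \<times> 'a" assume p: "p \<in> ?S"
  then obtain a where a: "A (fst p) = Some a" by auto
  show "?N p = 0 \<longleftrightarrow> p = 0"
    using generator_zero
    by (auto simp: graph_norm_def prod_eq_iff case_prod_beta add_nonneg_eq_0_iff)
  show "?N (r *\<^sub>C p) = cmod r * ?N p" for r
    using a generator_scaleC[OF a, of r]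
    by (simp add: case_prod_beta scaleC_prod_def graph_norm_def norm_scaleC distrib_left)
  assume "q \<in> ?S"
  then obtain b where b: "A (fst q) = Some b" by auto
  show "?N (p + q) \<le> ?N p + ?N q"
    using a b generator_add[OF a b] norm_triangle_ineq[of "fst p" "fst q"]
      norm_triangle_ineq[of a b] norm_triangle_ineq[of "snd p" "snd q"]
    by (simp add: case_prod_beta graph_norm_def)
next
  let ?S = "dom A \<times> (UNIV :: 'a set)" and ?N = "\<lambda>(x, y). graph_norm A x + norm y"
  fix f :: "nat \<Rightarrow> 'a \<times> 'a"
  assume S: "\<And>n. f n \<in> ?S"
    and cauchy: "\<And>e. e > 0 \<Longrightarrow> \<exists>k. \<forall>m\<ge>k. \<forall>n\<ge>k. ?N (f m - f n) < e"
  have N: "?N (f m - f n) = norm (fst (f m) - fst (f n))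
      + norm (the (A (fst (f m))) - the (A (fst (f n)))) + norm (snd (f m) - snd (f n))" for m n
    using S by (simp add: case_prod_beta graph_norm_diff mem_Times_iff)
  have "convergent g" if "\<And>m n. norm (g m - g n) \<le> ?N (f m - f n)" for g :: "nat \<Rightarrow> 'a"
    unfolding Cauchy_convergent_iff[symmetric]
  proof (rule CauchyI)
    fix e :: real assume "e > 0"
    then obtain k where "\<forall>m\<ge>k. \<forall>n\<ge>k. ?N (f m - f n) < e" using cauchy by blast
    then show "\<exists>M. \<forall>m\<ge>M. \<forall>n\<ge>M. norm (g m - g n) < e"
      using that by (meson order_le_less_trans)
  qed
  then have "convergent (\<lambda>n. fst (f n))" "convergent (\<lambda>n. the (A (fst (f n))))"
      "convergent (\<lambda>n. snd (f n))"
    by (simp_all add: N)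
  then obtain x a y where lim: "(\<lambda>n. fst (f n)) \<longlonglongrightarrow> x" "(\<lambda>n. the (A (fst (f n)))) \<longlonglongrightarrow> a"
      "(\<lambda>n. snd (f n)) \<longlonglongrightarrow> y"
    by (auto simp: convergent_def)
  have "A (fst (f n)) = Some (the (A (fst (f n))))" for n
    using S[of n] by auto
  from generator_closed[OF lim(1,2) this] have "A x = Some a" .
  then have l: "(x, y) \<in> ?S" by auto
  moreover have "(\<lambda>n. ?N (f n - (x, y))) \<longlonglongrightarrow> 0"
    using lim \<open>A x = Some a\<close> by (subst tendsto_graph_norm_iff[OF S l]) simp
  ultimately show "\<exists>l\<in>?S. (\<lambda>n. ?N (f n - l)) \<longlonglongrightarrow> 0" by blast
qed

end

subsection \<open>The factored second-order equation\<close>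

locale factored_wave_equation =
  E: strongly_continuous_group E A + B: strongly_continuous_group F B +
  P: strongly_continuous_group P "A_plus A B" + M: strongly_continuous_group M "A_minus A B"
  for E F P M :: "real \<Rightarrow> 'a::complex_banach \<Rightarrow> 'a" and A B :: "'a \<rightharpoonup> 'a" +
  assumes commute: "A \<circ>\<^sub>m B = B \<circ>\<^sub>m A"
    and dom_subset: "dom A \<subseteq> dom B"
    and invariant: "\<forall>x\<in>dom (A \<circ>\<^sub>m A). the (B x) \<in> dom A"
begin

lemma A_plus_eq: "A x = Some a \<Longrightarrow> B x = Some b \<Longrightarrow> A_plus A B x = Some (a - b)"
  by (auto simp: A_plus_def restrict_map_def)

lemma A_minus_eq: "A x = Some a \<Longrightarrow> B x = Some b \<Longrightarrow> A_minus A B x = Some (- a - b)"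
  by (auto simp: A_minus_def restrict_map_def)

lemma in_dom_B: "A x = Some a \<Longrightarrow> \<exists>b. B x = Some b"
  using dom_subset by blast

lemma A_plus_cases:
  assumes "A_plus A B x = Some z"
  obtains a b where "A x = Some a" "B x = Some b" "z = a - b"
  using assms in_dom_B by (fastforce simp: A_plus_def restrict_map_def split: if_splits)

lemma A_minus_cases:
  assumes "A_minus A B x = Some z"
  obtains a b where "A x = Some a" "B x = Some b" "z = - a - b"
  using assms in_dom_B by (fastforce simp: A_minus_def restrict_map_def split: if_splits)

lemma A_B_eq_B_A:
  assumes "A x = Some a" "A a = Some a'" "B x = Some b"
  obtains e where "A b = Some e" "B a = Some e"
proof -
  have "x \<in> dom (A \<circ>\<^sub>m A)" using assms by (simp add: domIff map_comp_def)
  then have "the (B x) \<in> dom A" using invariant by blast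
  then obtain e where e: "A b = Some e" using assms(3) by auto
  have "B a = (B \<circ>\<^sub>m A) x" using assms(1) by simp
  also have "\<dots> = A b" using assms(3) by (simp flip: commute)
  finally show ?thesis using e by (intro that) simp_all
qed

lemma P_M_generator_A:
  assumes a: "A x = Some a"
  shows "A (P t x) = Some (P t a)" "A (M t x) = Some (M t a)"
proof -
  obtain \<omega> R where R: "bounded_linear R" "\<And>x. A (R x) = Some (\<omega> *\<^sub>R R x - x)"
      "\<And>x y. A x = Some y \<Longrightarrow> R (\<omega> *\<^sub>R x - y) = x"
    by (rule E.resolvent_exists) (rule that)
  interpret R: bounded_linear R by (rule R(1))
  have RA: "A (R x) = Some (R a)" if "A x = Some a" for x a
  proof -
    have "R a = \<omega> *\<^sub>R R x - x"
      using R(3)[OF that] by (simp add: R.diff R.scaleR algebra_simps)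
    then show ?thesis by (simp add: R(2))
  qed
  have RB: "B (R x) = Some (R b)" if a: "A x = Some a" and b: "B x = Some b" for x a b
  proof -
    define y where "y = \<omega> *\<^sub>R R x - x"
    have y: "A (R x) = Some y" by (simp add: y_def R(2))
    have "A y = Some (\<omega> *\<^sub>R y - a)"
      using E.generator_diff[OF E.generator_scaleR[OF y] a] by (simp add: y_def)
    moreover obtain b' where b': "B (R x) = Some b'" using in_dom_B[OF y] by blast
    ultimately obtain e where e: "A b' = Some e" "B y = Some e"
      using A_B_eq_B_A[OF y] by blast
    have "B y = Some (\<omega> *\<^sub>R b' - b)"
      using B.generator_diff[OF B.generator_scaleR[OF b'] b] by (simp add: y_def)
    then have "\<omega> *\<^sub>R b' - e = b" using e(2) by (simp add: algebra_simps)
    then show ?thesis using R(3)[OF e(1)] b' by simp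
  qed
  have "A_plus A B (R x) = Some (R z)" if "A_plus A B x = Some z" for x z
    using that RA RB by (auto elim!: A_plus_cases simp: A_plus_eq R.diff)
  then have RP: "R (P t x) = P t (R x)" for t x by (rule P.commute_T[OF R(1)])
  have "A_minus A B (R x) = Some (R z)" if "A_minus A B x = Some z" for x z
    using that RA RB by (auto elim!: A_minus_cases simp: A_minus_eq R.diff linear_neg[OF R.linear])
  then have RM: "R (M t x) = M t (R x)" for t x by (rule M.commute_T[OF R(1)])
  show "A (P t x) = Some (P t a)"
    using R(2)[of "P t (\<omega> *\<^sub>R x - a)"]
    by (simp only: RP R(3)[OF a]) (simp add: P.T.diff P.T.scaleR)
  show "A (M t x) = Some (M t a)"
    using R(2)[of "M t (\<omega> *\<^sub>R x - a)"]
    by (simp only: RM R(3)[OF a]) (simp add: M.T.diff M.T.scaleR)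
qed

lemma P_generator_B:
  assumes "A x = Some a" "B x = Some b"
  shows "B (P t x) = Some (P t b)"
proof -
  have "A_plus A B (P t x) = Some (P t (a - b))"
    by (rule P.generator_T[OF A_plus_eq[OF assms]])
  then show ?thesis
    using P_M_generator_A(1)[OF assms(1)] by (auto elim!: A_plus_cases simp: P.T.diff)
qed

lemma P_E: "P t (E s x) = E s (P t x)"
  by (rule E.commute_T[OF P.bounded_linear_T]) (rule P_M_generator_A)

lemma M_E: "M t (E s x) = E s (M t x)"
  by (rule E.commute_T[OF M.bounded_linear_T]) (rule P_M_generator_A)

definition Q :: "real \<Rightarrow> 'a \<Rightarrow> 'a" where
  "Q t = E (- 2 * t)"

sublocale Q: strongly_continuous_group Q "generator UNIV norm Q"
  using E.generates_rescaled[of 0 "- 2"] by (simp add: Q_def[abs_def])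

lemma generator_Q: "generator UNIV norm Q x = Some (- 2 *\<^sub>R a) \<longleftrightarrow> A x = Some a"
  using E.generator_rescaled_iff[of "- 2" 0 x a] by (simp add: Q_def[abs_def])

lemma P_Q: "P t (Q s x) = Q s (P t x)"
  by (simp add: Q_def P_E)

lemma M_Q: "M t (Q s x) = Q s (M t x)"
  by (simp add: Q_def M_E)

text \<open>Both sides solve \<open>u' = (- A - B) u\<close>, since formally \<open>P t = exp (t A) exp (- t B)\<close>.\<close>

lemma M_eq: "M t x = Q t (P t x)"
proof -
  have "M t x = E (- t) (E (- t) (P t x))"
  proof (rule E.bounded_linear_eqI[where F = "M t" and G = "\<lambda>x. E (- t) (E (- t) (P t x))"])
    fix x a assume a: "A x = Some a"
    obtain b where b: "B x = Some b" using in_dom_B[OF a] by blast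
    define u where "u s = E (- s) (E (- s) (P s x))" for s
    have "u t = M t (u 0)"
    proof (rule M.Cauchy_problem_unique)
      fix s
      have AP: "A (P s x) = Some (P s a)" by (rule P_M_generator_A[OF a])
      have "A_minus A B (P s x) = Some (- P s a - P s b)"
        by (rule A_minus_eq[OF AP P_generator_B[OF a b]])
      then have "A_minus A B (u s) = Some (E (- s) (E (- s) (- P s a - P s b)))"
        unfolding u_def
        by (intro M.generator_bounded_linear[OF E.bounded_linear_T] M_E[symmetric])
      moreover have "((\<lambda>r. E (-1 * r) (P r x)) has_vector_derivative
          E (-1 * s) (P s (a - b) + -1 *\<^sub>R P s a)) (at s)"
        by (intro E.has_vector_derivative_T_mult P.has_vector_derivative_T A_plus_eq a b AP)
      then have "((\<lambda>r. E (-1 * r) (E (-1 * r) (P r x))) has_vector_derivative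
          E (-1 * s) (E (-1 * s) (P s (a - b) + -1 *\<^sub>R P s a) + -1 *\<^sub>R E (-1 * s) (P s a))) (at s)"
        by (rule E.has_vector_derivative_T_mult) (rule E.generator_T[OF AP])
      then have "(u has_vector_derivative E (- s) (E (- s) (- P s a - P s b))) (at s)"
        by (simp add: u_def[abs_def] P.T.diff E.T.diff linear_neg[OF E.T.linear] algebra_simps)
      ultimately show "\<exists>z. A_minus A B (u s) = Some z \<and> (u has_vector_derivative z) (at s)"
        by blast
    qed
    then show "M t x = E (- t) (E (- t) (P t x))" by (simp add: u_def)
  qed (intro M.bounded_linear_T bounded_linear_compose[OF E.bounded_linear_T]
      P.bounded_linear_T)+
  then show ?thesis by (simp add: Q_def flip: E.T_add)
qed

lemma P_M_commute: "P s (M t x) = M t (P s x)"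
  by (simp add: M_eq P_Q P.T_commute[of s t])

definition W :: "real \<Rightarrow> 'a \<Rightarrow> 'a" where
  "W t y = P t (Q.J t y)"

lemma oriented_integral_eq_W: "oriented_integral 0 t (\<lambda>\<tau>. P (t - \<tau>) (M \<tau> y)) = W t y"
proof -
  have "P (t - \<tau>) (M \<tau> y) = P t (Q \<tau> y)" for \<tau>
    using P.T_add[of t "- \<tau>"] by (simp add: M_eq P_Q)
  then show ?thesis
    by (simp add: W_def Q.J_def oriented_integral_bounded_linear[OF P.bounded_linear_T Q.continuous_on_T])
qed

lemma bounded_linear_W: "bounded_linear (W t)"
  unfolding W_def by (rule bounded_linear_compose[OF P.bounded_linear_T Q.bounded_linear_J])

sublocale W: bounded_linear "W t" for t
  by (rule bounded_linear_W)

lemma W_scaleC: "W t (a *\<^sub>C y) = a *\<^sub>C W t y"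
  by (simp add: W_def Q.J_scaleC P.T_scaleC)

lemma P_W: "P s (W t y) = W t (P s y)"
  by (simp add: W_def P.T_commute[of s t]
      Q.J_bounded_linear_commute[OF P.bounded_linear_T] P_Q)

lemma M_W: "M s (W t y) = W t (M s y)"
  by (simp add: W_def Q.J_bounded_linear_commute[OF M.bounded_linear_T] M_Q flip: P_M_commute)

lemma W_add: "W (s + t) y = P t (W s y) + M s (W t y)"
proof -
  have "P (s + t) (Q.J s y) = P t (P s (Q.J s y))"
    by (simp add: add.commute flip: P.T_add)
  moreover have "P (s + t) (Q s (Q.J t y)) = M s (P t (Q.J t y))"
    by (simp add: M_eq P.T_add P_Q)
  ultimately show ?thesis by (simp only: W_def Q.J_add P.T.add)
qed

lemma generator_W: "A (W t y) = Some ((1 / 2) *\<^sub>R (P t y - M t y))"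
proof -
  have "A (Q.J t y) = Some ((1 / 2) *\<^sub>R (y - Q t y))"
    using Q.generator_J[of t y] by (intro generator_Q[THEN iffD1]) (simp add: algebra_simps)
  from P_M_generator_A(1)[OF this] show ?thesis
    by (simp add: W_def P.T.scaleR P.T.diff M_eq P_Q)
qed

lemma W_generator:
  assumes "A x = Some a"
  shows "W t a = (1 / 2) *\<^sub>R (P t x - M t x)"
proof -
  interpret J: bounded_linear "Q.J t" by (rule Q.bounded_linear_J)
  have "- 2 *\<^sub>R Q.J t a = Q t x - x"
    using Q.J_generator[OF generator_Q[THEN iffD2, OF assms], of t] by (simp add: linear_neg[OF J.linear] J.scaleR)
  then have "(- 1 / 2) *\<^sub>R (- 2 *\<^sub>R Q.J t a) = (- 1 / 2) *\<^sub>R (Q t x - x)" by simp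
  then have "Q.J t a = (1 / 2) *\<^sub>R (x - Q t x)" by (simp add: algebra_simps)
  then show ?thesis by (simp add: W_def P.T.scaleR P.T.diff M_eq P_Q)
qed

lemma has_vector_derivative_W_zero: "((\<lambda>t. W t y) has_vector_derivative y) (at 0)"
proof -
  have "((\<lambda>t. (1 / t) *\<^sub>R Q.J t y) \<longlongrightarrow> y) (at 0)"
    using Q.has_vector_derivative_J[of y 0] by (simp add: has_vector_derivative_iff_tendsto)
  from P.tendsto_T[OF tendsto_ident_at this]
  show ?thesis by (simp add: has_vector_derivative_iff_tendsto W_def P.T.scaleR P.T.zero)
qed

definition C :: "real \<Rightarrow> 'a \<Rightarrow> 'a" where
  "C t x = (1 / 2) *\<^sub>R (P t x + M t x)"

definition S :: "real \<Rightarrow> 'a \<Rightarrow> 'a" where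
  "S t x = (1 / 2) *\<^sub>R (P t x - M t x)"

lemma P_eq_C_S: "P t x = C t x + S t x"
proof -
  have "C t x + S t x = (1 / 2 + 1 / 2) *\<^sub>R P t x"
    unfolding C_def S_def scaleR_add_left by (simp add: scaleR_add_right scaleR_diff_right)
  then show ?thesis by simp
qed

lemma M_eq_C_S: "M t x = C t x - S t x"
proof -
  have "C t x - S t x = (1 / 2 + 1 / 2) *\<^sub>R M t x"
    unfolding C_def S_def scaleR_add_left by (simp add: scaleR_add_right scaleR_diff_right)
  then show ?thesis by simp
qed

lemma bounded_linear_C: "bounded_linear (C t)"
  unfolding C_def
  by (intro bounded_linear_compose[OF bounded_linear_scaleR_right] bounded_linear_add
      P.bounded_linear_T M.bounded_linear_T)

lemma bounded_linear_S: "bounded_linear (S t)"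
  unfolding S_def
  by (intro bounded_linear_compose[OF bounded_linear_scaleR_right] bounded_linear_sub
      P.bounded_linear_T M.bounded_linear_T)

sublocale C: bounded_linear "C t" for t by (rule bounded_linear_C)
sublocale S: bounded_linear "S t" for t by (rule bounded_linear_S)

lemma C_scaleC: "C t (a *\<^sub>C x) = a *\<^sub>C C t x"
  by (simp add: C_def P.T_scaleC M.T_scaleC scaleC_scaleR_commute flip: scaleC_add_right)

lemma S_scaleC: "S t (a *\<^sub>C x) = a *\<^sub>C S t x"
proof -
  have "a *\<^sub>C u - a *\<^sub>C v = a *\<^sub>C (u - v)" for u v :: 'a
    using bounded_linear.linear[OF bounded_linear_scaleC] linear_diff by metis
  then show ?thesis
    by (simp add: S_def P.T_scaleC M.T_scaleC scaleC_scaleR_commute)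
qed

lemma C_zero [simp]: "C 0 x = x" and S_zero [simp]: "S 0 x = 0" and W_zero [simp]: "W 0 x = 0"
  by (simp_all add: C_def S_def W_def P.T.zero flip: scaleR_2)

lemma generator_C: "A x = Some a \<Longrightarrow> A (C t x) = Some (C t a)"
  unfolding C_def by (intro E.generator_scaleR E.generator_add P_M_generator_A)

lemma generator_S: "A x = Some a \<Longrightarrow> A (S t x) = Some (S t a)"
  unfolding S_def by (intro E.generator_scaleR E.generator_diff P_M_generator_A)

lemma generator_C_add_W: "A x = Some a \<Longrightarrow> A (C t x + W t y) = Some (C t a + S t y)"
  unfolding S_def by (intro E.generator_add generator_C generator_W)

lemma C_add: "C (s + t) x = C s (C t x) + S s (S t x)"
  and S_add: "S (s + t) x = S s (C t x) + C s (S t x)"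
proof -
  have P: "C (s + t) x + S (s + t) x = C s (C t x) + S s (C t x) + (C s (S t x) + S s (S t x))"
    using P.T_add[of s t x] by (simp only: P_eq_C_S C.add S.add) simp
  have M: "C (s + t) x - S (s + t) x = C s (C t x) - S s (C t x) - (C s (S t x) - S s (S t x))"
    using M.T_add[of s t x] by (simp only: M_eq_C_S C.diff S.diff) simp
  have "u = u' \<and> v = v'" if "u + v = u' + v'" "u - v = u' - v'" for u v u' v' :: 'a
  proof -
    have "2 *\<^sub>R u = 2 *\<^sub>R u'" using arg_cong2[OF that, of "(+)"] by (simp add: scaleR_2 algebra_simps)
    then show ?thesis using that by simp
  qed
  from this[of "C (s + t) x" "S (s + t) x" "C s (C t x) + S s (S t x)" "S s (C t x) + C s (S t x)"]
  show "C (s + t) x = C s (C t x) + S s (S t x)" "S (s + t) x = S s (C t x) + C s (S t x)"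
    using P M by (simp_all add: algebra_simps)
qed

lemma C_W: "C s (W t y) = W t (C s y)"
  by (simp add: C_def P_W M_W W.scaleR W.add)

lemma W_add_C: "W (s + t) y = C s (W t y) + W s (C t y)"
proof -
  have "W (s + t) y = (1 / 2) *\<^sub>R (W (s + t) y + W (t + s) y)"
    by (simp add: add.commute flip: scaleR_2)
  also have "W (s + t) y + W (t + s) y = (P s (W t y) + M s (W t y)) + (P t (W s y) + M t (W s y))"
    by (simp add: W_add[of s t] W_add[of t s])
  finally have "W (s + t) y = C s (W t y) + C t (W s y)"
    by (simp add: C_def scaleR_add_right)
  then show ?thesis by (simp add: C_W)
qed

lemma T_matrix_eq:
  "A x = Some a \<Longrightarrow> T_matrix A P M t (x, y) = (C t x + W t y, S t a + C t y)"
  by (simp add: T_matrix_def oriented_integral_eq_W C_def S_def)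

abbreviation "state_space \<equiv> dom A \<times> (UNIV :: 'a set)"
abbreviation "state_norm \<equiv> \<lambda>(x :: 'a, y :: 'a). graph_norm A x + norm y"

lemma T_matrix_in_state_space:
  assumes "p \<in> state_space"
  shows "T_matrix A P M t p \<in> state_space"
  using assms generator_C_add_W by (fastforce simp: T_matrix_eq)

lemma C0_group_T_matrix: "C0_group state_space state_norm (T_matrix A P M)"
  unfolding C0_group_def
proof (intro conjI allI ballI)
  show "complex_banach_on state_space state_norm" by (rule E.complex_banach_on_graph_norm)
next
  fix t
  obtain c s w where bounds: "\<And>x. norm (C t x) \<le> norm x * c" "\<And>x. norm (S t x) \<le> norm x * s"
      "\<And>x. norm (W t x) \<le> norm x * w" "c \<ge> 0" "s \<ge> 0" "w \<ge> 0"
    using C.nonneg_bounded[of t] S.nonneg_bounded[of t] W.nonneg_bounded[of t] by metis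
  show "bounded_clinear_on state_space state_norm (T_matrix A P M t)"
    unfolding bounded_clinear_on_def
  proof (intro conjI ballI allI exI)
    fix p assume "p \<in> state_space"
    then obtain x a y where p: "p = (x, y)" "A x = Some a" by auto
    show "T_matrix A P M t p \<in> state_space"
      by (rule T_matrix_in_state_space[OF \<open>p \<in> state_space\<close>])
    show "T_matrix A P M t (r *\<^sub>C p) = r *\<^sub>C T_matrix A P M t p" for r
      using p E.generator_scaleC[OF p(2), of r]
      by (simp add: scaleC_prod_def T_matrix_eq C_scaleC S_scaleC W_scaleC scaleC_add_right)
    show "state_norm (T_matrix A P M t p) \<le> (c + s + w) * state_norm p"
    proof -
      have "norm (C t x + W t y) \<le> norm x * c + norm y * w"
        by (intro norm_triangle_le add_mono bounds)
      moreover have "norm (C t a + S t y) \<le> norm a * c + norm y * s"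
        by (intro norm_triangle_le add_mono bounds)
      moreover have "norm (S t a + C t y) \<le> norm a * s + norm y * c"
        by (intro norm_triangle_le add_mono bounds)
      ultimately have "state_norm (T_matrix A P M t p) \<le>
          norm x * c + norm a * (c + s) + norm y * (c + s + w)"
        using generator_C_add_W[OF p(2), of t y] p
        by (simp add: T_matrix_eq graph_norm_def algebra_simps)
      moreover have "norm x * c \<le> norm x * (c + s + w)" "norm a * (c + s) \<le> norm a * (c + s + w)"
        using bounds by (auto intro!: mult_left_mono)
      ultimately show ?thesis using p by (simp add: graph_norm_def algebra_simps)
    qed
    fix q assume "q \<in> state_space"
    then obtain x' a' y' where q: "q = (x', y')" "A x' = Some a'" by auto
    show "T_matrix A P M t (p + q) = T_matrix A P M t p + T_matrix A P M t q"
      using p q E.generator_add[OF p(2) q(2)]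
      by (simp add: T_matrix_eq C.add S.add W.add algebra_simps)
  qed
next
  fix p assume "p \<in> state_space"
  then obtain x a y where p: "p = (x, y)" "A x = Some a" by auto
  then show "T_matrix A P M 0 p = p" by (simp add: T_matrix_eq)
next
  fix s t p assume "p \<in> state_space"
  then obtain x a y where p: "p = (x, y)" "A x = Some a" by auto
  have "W s (S t a) = S s (S t x)"
    using W_generator[OF generator_S[OF p(2)], of s t] by (simp add: S_def[of s])
  moreover have "S s (S t y) = S s (the (A (W t y)))"
    by (simp add: generator_W S_def[of t])
  ultimately show "T_matrix A P M (s + t) p = T_matrix A P M s (T_matrix A P M t p)"
    using p generator_C_add_W[OF p(2), of t y]
    by (simp add: T_matrix_eq C_add S_add W_add_C C.add S.add W.add algebra_simps)
next
  fix p t assume p_in: "p \<in> state_space"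
  then obtain x a y where p: "p = (x, y)" "A x = Some a" by auto
  have lim: "((\<lambda>s. C s z) \<longlongrightarrow> C t z) (at t)" "((\<lambda>s. S s z) \<longlongrightarrow> S t z) (at t)" for z
    unfolding C_def S_def by (intro tendsto_intros P.tendsto_T M.tendsto_T)+
  have "((\<lambda>s. Q.J s z) \<longlongrightarrow> Q.J t z) (at t)" for z
    using has_vector_derivative_continuous[OF Q.has_vector_derivative_J]
    by (simp add: isCont_def)
  then have W: "((\<lambda>s. W s z) \<longlongrightarrow> W t z) (at t)" for z
    unfolding W_def by (intro P.tendsto_T tendsto_ident_at)
  have "((\<lambda>s. state_norm (T_matrix A P M s p - T_matrix A P M t p)) \<longlongrightarrow> 0) (at t)"
    using p generator_C_add_W[OF p(2), of _ y] T_matrix_in_state_space[OF p_in]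
    by (subst E.tendsto_graph_norm_iff) (auto simp: T_matrix_eq intro!: tendsto_intros lim W)
  then show "((\<lambda>s. state_norm (T_matrix A P M s p - T_matrix A P M t p)) \<longlongrightarrow> 0) (at t)" .
qed

lemma G_matrix_eq_Some_iff:
  "G_matrix A B (x, y) = Some w \<longleftrightarrow> (\<exists>a a' b c. A x = Some a \<and> A a = Some a' \<and> B x = Some b \<and>
     B y = Some c \<and> y \<in> dom A \<and> w = (- b + y, a' - c))"
  using in_dom_B[of x] in_dom_B[of y]
  by (auto simp: G_matrix_def restrict_map_def map_comp_def split: option.splits if_splits)

lemma C_derivative:
  assumes "A x = Some a" "B x = Some b"
  shows "((\<lambda>t. C t x) has_vector_derivative - b) (at 0)"
proof -
  have "((\<lambda>t. C t x) has_vector_derivative (1 / 2) *\<^sub>R ((a - b) + (- a - b))) (at 0)"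
    unfolding C_def
    by (intro bounded_linear.has_vector_derivative[OF bounded_linear_scaleR_right]
        has_vector_derivative_add P.generator_iff[THEN iffD1] M.generator_iff[THEN iffD1]
        A_plus_eq A_minus_eq assms)
  moreover have "(1 / 2) *\<^sub>R ((a - b) + (- a - b)) = - b"
    by (simp add: algebra_simps flip: scaleR_2)
  ultimately show ?thesis by simp
qed

lemma S_derivative:
  assumes "A x = Some a"
  shows "((\<lambda>t. S t x) has_vector_derivative a) (at 0)"
proof -
  obtain b where b: "B x = Some b" using in_dom_B[OF assms] by blast
  have "((\<lambda>t. S t x) has_vector_derivative (1 / 2) *\<^sub>R ((a - b) - (- a - b))) (at 0)"
    unfolding S_def
    by (intro bounded_linear.has_vector_derivative[OF bounded_linear_scaleR_right]
        has_vector_derivative_diff P.generator_iff[THEN iffD1] M.generator_iff[THEN iffD1]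
        A_plus_eq A_minus_eq assms b)
  moreover have "(1 / 2) *\<^sub>R ((a - b) - (- a - b)) = a"
    by (simp add: algebra_simps flip: scaleR_2)
  ultimately show ?thesis by simp
qed

lemma T_matrix_difference_quotient_iff:
  assumes a: "A x = Some a" and r: "A u = Some r"
  shows "((\<lambda>t. state_norm ((1 / t) *\<^sub>R (T_matrix A P M t (x, y) - (x, y)) - (u, v))) \<longlongrightarrow> 0) (at 0) \<longleftrightarrow>
    ((\<lambda>t. C t x + W t y) has_vector_derivative u) (at 0) \<and>
    ((\<lambda>t. C t a + S t y) has_vector_derivative r) (at 0) \<and>
    ((\<lambda>t. S t a + C t y) has_vector_derivative v) (at 0)"
proof -
  have AD: "A ((1 / t) *\<^sub>R (C t x + W t y - x)) = Some ((1 / t) *\<^sub>R (C t a + S t y - a))" for t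
    by (intro E.generator_scaleR E.generator_diff generator_C_add_W a)
  have D: "(1 / t) *\<^sub>R (T_matrix A P M t (x, y) - (x, y)) =
      ((1 / t) *\<^sub>R (C t x + W t y - x), (1 / t) *\<^sub>R (S t a + C t y - y))" for t
    by (simp add: T_matrix_eq[OF a] minus_prod_def scaleR_prod_def)
  have "(1 / t) *\<^sub>R (T_matrix A P M t (x, y) - (x, y)) \<in> state_space" for t
    using AD[of t] by (simp only: D) auto
  then show ?thesis
    using r by (subst E.tendsto_graph_norm_iff)
      (auto simp: D AD has_vector_derivative_iff_tendsto)
qed

lemma G_matrix_has_derivative:
  assumes "G_matrix A B (x, y) = Some (u, v)" "A x = Some a"
  obtains r where "A u = Some r" "((\<lambda>t. C t x + W t y) has_vector_derivative u) (at 0)"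
    "((\<lambda>t. C t a + S t y) has_vector_derivative r) (at 0)"
    "((\<lambda>t. S t a + C t y) has_vector_derivative v) (at 0)"
proof -
  obtain a' b c d where *: "A a = Some a'" "B x = Some b" "B y = Some c" "A y = Some d"
      "u = - b + y" "v = a' - c"
    using assms by (auto simp: G_matrix_eq_Some_iff)
  obtain e where e: "A b = Some e" "B a = Some e"
    using A_B_eq_B_A[OF assms(2) *(1,2)] by blast
  have "A u = Some (- e + d)"
    using E.generator_diff[OF *(4) e(1)] by (simp add: *(5))
  moreover have "((\<lambda>t. C t x + W t y) has_vector_derivative u) (at 0)"
    unfolding *(5)
    by (intro has_vector_derivative_add C_derivative[OF assms(2) *(2)] has_vector_derivative_W_zero)
  moreover have "((\<lambda>t. C t a + S t y) has_vector_derivative - e + d) (at 0)"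
    by (intro has_vector_derivative_add C_derivative[OF *(1) e(2)] S_derivative[OF *(4)])
  moreover have "((\<lambda>t. S t a + C t y) has_vector_derivative a' + - c) (at 0)"
    by (intro has_vector_derivative_add C_derivative[OF *(4,3)] S_derivative[OF *(1)])
  ultimately show ?thesis using that *(6) by simp
qed

lemma differentiable_imp_in_dom_G_matrix:
  assumes a: "A x = Some a"
    and 1: "((\<lambda>t. C t a + S t y) has_vector_derivative r) (at 0)"
    and 2: "((\<lambda>t. S t a + C t y) has_vector_derivative v) (at 0)"
  shows "\<exists>w. G_matrix A B (x, y) = Some w"
proof -
  have "((\<lambda>t. P t (a + y)) has_vector_derivative r + v) (at 0)"
    using has_vector_derivative_add[OF 1 2] by (simp add: P_eq_C_S C.add S.add algebra_simps)
  then obtain p where p: "A (a + y) = Some p"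
    using P.generator_iff A_plus_cases by metis
  have "((\<lambda>t. M t (a - y)) has_vector_derivative r - v) (at 0)"
    using has_vector_derivative_diff[OF 1 2] by (simp add: M_eq_C_S C.diff S.diff algebra_simps)
  then obtain m where m: "A (a - y) = Some m"
    using M.generator_iff A_minus_cases by metis
  have "(1 / 2) *\<^sub>R ((a + y) + (a - y)) = a" "(1 / 2) *\<^sub>R ((a + y) - (a - y)) = y"
    by (simp_all add: algebra_simps flip: scaleR_2)
  then have "A a = Some ((1 / 2) *\<^sub>R (p + m))" "A y = Some ((1 / 2) *\<^sub>R (p - m))"
    using E.generator_scaleR[OF E.generator_add[OF p m], of "1 / 2"]
      E.generator_scaleR[OF E.generator_diff[OF p m], of "1 / 2"] by simp_all
  moreover from this(2) obtain c where "B y = Some c" using in_dom_B by blast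
  moreover obtain b where "B x = Some b" using in_dom_B[OF a] by blast
  ultimately show ?thesis
    using a by (auto simp: G_matrix_eq_Some_iff)
qed

lemma G_matrix_iff_lim:
  assumes p: "p \<in> state_space"
  shows "w \<in> state_space \<and>
      ((\<lambda>t. state_norm ((1 / t) *\<^sub>R (T_matrix A P M t p - p) - w)) \<longlongrightarrow> 0) (at 0) \<longleftrightarrow>
    G_matrix A B p = Some w"
proof -
  obtain x a y where xy: "p = (x, y)" and a: "A x = Some a" using p by auto
  obtain u v where w: "w = (u, v)" by force
  show ?thesis
    unfolding xy w
  proof
    assume *: "G_matrix A B (x, y) = Some (u, v)"
    from G_matrix_has_derivative[OF * a] obtain r where r: "A u = Some r"
      "((\<lambda>t. C t x + W t y) has_vector_derivative u) (at 0)"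
      "((\<lambda>t. C t a + S t y) has_vector_derivative r) (at 0)"
      "((\<lambda>t. S t a + C t y) has_vector_derivative v) (at 0)" .
    then show "(u, v) \<in> state_space \<and>
        ((\<lambda>t. state_norm ((1 / t) *\<^sub>R (T_matrix A P M t (x, y) - (x, y)) - (u, v))) \<longlongrightarrow> 0) (at 0)"
      using T_matrix_difference_quotient_iff[OF a r(1)] by blast
  next
    assume *: "(u, v) \<in> state_space \<and>
        ((\<lambda>t. state_norm ((1 / t) *\<^sub>R (T_matrix A P M t (x, y) - (x, y)) - (u, v))) \<longlongrightarrow> 0) (at 0)"
    then obtain r where r: "A u = Some r" by auto
    have d: "((\<lambda>t. C t x + W t y) has_vector_derivative u) (at 0)"
        "((\<lambda>t. C t a + S t y) has_vector_derivative r) (at 0)"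
        "((\<lambda>t. S t a + C t y) has_vector_derivative v) (at 0)"
      using * T_matrix_difference_quotient_iff[OF a r] by blast+
    obtain u' v' where G: "G_matrix A B (x, y) = Some (u', v')"
      using differentiable_imp_in_dom_G_matrix[OF a d(2,3)] by auto
    from G_matrix_has_derivative[OF G a] have "u' = u" "v' = v"
      using d vector_derivative_unique_at by metis+
    then show "G_matrix A B (x, y) = Some (u, v)" using G by simp
  qed
qed

lemma generator_T_matrix: "generator state_space state_norm (T_matrix A P M) = G_matrix A B"
proof
  fix p
  show "generator state_space state_norm (T_matrix A P M) p = G_matrix A B p"
  proof (cases "p \<in> state_space")
    case True
    then show ?thesis
      unfolding generator_def Let_def restrict_map_def mem_Collect_eq G_matrix_iff_lim[OF True]
      by (cases "G_matrix A B p") simp_all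
  next
    case False
    moreover have "p \<in> state_space" if "G_matrix A B p = Some w" for w
      using that by (cases p) (auto simp: G_matrix_eq_Some_iff)
    ultimately show ?thesis
      unfolding generator_def Let_def by (cases "G_matrix A B p") (auto simp: restrict_map_def)
  qed
qed

end

theorem lemma2p1:
  fixes A0 B0 :: "'a::complex_banach \<rightharpoonup> 'a"
    and expA expB expP expM :: "real \<Rightarrow> 'a \<Rightarrow> 'a"
  assumes "generates_C0_group UNIV norm A0 expA"
    and "generates_C0_group UNIV norm B0 expB"
    and "A0 \<circ>\<^sub>m B0 = B0 \<circ>\<^sub>m A0"
    and "dom A0 \<subseteq> dom B0"
    and "\<forall>x \<in> dom (A0 \<circ>\<^sub>m A0). the (B0 x) \<in> dom A0"
    and "generates_C0_group UNIV norm (A_plus A0 B0) expP"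
    and "generates_C0_group UNIV norm (A_minus A0 B0) expM"
  shows "generates_C0_group (dom A0 \<times> UNIV) (\<lambda>(x, y). graph_norm A0 x + norm y)
           (G_matrix A0 B0) (T_matrix A0 expP expM)"
proof -
  interpret factored_wave_equation expA expB expP expM A0 B0
    by unfold_locales (fact assms)+
  show ?thesis
    unfolding generates_C0_group_def
    using C0_group_T_matrix generator_T_matrix by simp
qed

end
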